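(* For any $A\in\mathbb{R}^{m\times n}$, the solution mapping $$S(b,\lambda):=\mathrm{argmin}_{x\in\mathbb{R}^n}\left\{\tfrac12\|Ax-b\|^2+\lambda\|x\|_1\right\}$$ of the LASSO problem is globally (Hausdorff) Lipschitz continuous on $\mathbb{R}^m\times\mathbb{R}_{++}$; that is, there exists $\kappa\in(0,\infty)$ such that $d_H(S(b,\lambda),S(b',\lambda'))\le\kappa\|(b,\lambda)-(b',\lambda')\|$ for all $(b,\lambda),(b',\lambda')\in\mathbb{R}^m\times\mathbb{R}_{++}$.
   Context: $\mathbb{R}_{++}=(0,\infty)$; $\|\cdot\|$ is the Euclidean norm and $\|\cdot\|_1$ the $\ell_1$-norm. $d_H(C,D)=\max\{e(C,D),e(D,C)\}$ with $e(C,D)=\sup_{x\in C}d(x,D)$ is the Hausdorff distance. $S$ is a set-valued mapping. *)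

theory Defs
  imports "HOL-Analysis.Analysis"
begin

(* The distances below take values in the extended nonnegative reals: an excess can be infinite,
   the distance to the empty set is \<infinity> (whereas the library's infdist x {} is 0), and the
   excess of the empty set is 0. *)

definition point_set_dist :: "'a::metric_space \<Rightarrow> 'a set \<Rightarrow> ennreal"
  where "point_set_dist x D = (INF y\<in>D. ennreal (dist x y))"

definition excess :: "'a::metric_space set \<Rightarrow> 'a set \<Rightarrow> ennreal"
  where "excess C D = (SUP x\<in>C. point_set_dist x D)"

definition hausdorff_dist :: "'a::metric_space set \<Rightarrow> 'a set \<Rightarrow> ennreal"
  where "hausdorff_dist C D = max (excess C D) (excess D C)"

definition l1_norm :: "real ^ 'n \<Rightarrow> real"
  where "l1_norm x = (\<Sum>i\<in>UNIV. \<bar>x $ i\<bar>)"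

definition lasso_objective ::
    "real ^ 'n ^ 'm \<Rightarrow> real ^ 'm \<Rightarrow> real \<Rightarrow> real ^ 'n \<Rightarrow> real"
  where "lasso_objective A b l x = 1 / 2 * (norm (A *v x - b))\<^sup>2 + l * l1_norm x"

definition lasso_solutions ::
    "real ^ 'n ^ 'm \<Rightarrow> (real ^ 'm) \<times> real \<Rightarrow> (real ^ 'n) set"
  where "lasso_solutions A = (\<lambda>(b, l). {x. is_arg_min (lasso_objective A b l) (\<lambda>_. True) x})"

end

theory Submission
  imports Defs
begin

text \<open>
  Fix a solution \<open>x\<close> for the data \<open>(b, l)\<close>, and let \<open>x'\<close> be the point nearest to \<open>x\<close> among the
  solutions for \<open>(b', l')\<close>. The bound on \<open>norm (x' - x)\<close> comes from two estimates that feed each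
  other.

  First, \<open>d = x' - x\<close> is controlled by its image under \<open>A\<close>. Suppose that a nonzero \<open>k\<close> in the kernel
  of \<open>A\<close> has the signs of \<open>d\<close>, that is, it lies in the smallest closed face of an orthant containing
  \<open>d\<close>. For small \<open>\<epsilon> > 0\<close> both \<open>x + \<epsilon> k\<close> and \<open>x' - \<epsilon> k\<close> lie coordinatewise between \<open>x\<close> and \<open>x'\<close>,
  and convexity of the absolute value shows that the step from \<open>x'\<close> decreases the l1-norm by at
  least as much as the step from \<open>x\<close> increases it (\<open>l1_norm_transfer\<close>). Neither step changes the
  quadratic term, so optimality of \<open>x\<close> makes that amount nonnegative, and \<open>x' - \<epsilon> k\<close> is another
  solution for \<open>(b', l')\<close>, strictly nearer to \<open>x\<close>: a contradiction. Hence the face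
  of \<open>d\<close> meets the kernel only in \<open>0\<close>, and compactness gives \<open>norm d \<le> c * norm (A *v d)\<close>; as there are only
  finitely many faces, a single \<open>c\<close> serves for all data (\<open>norm_le_image_if_no_conformal_kernel\<close>).

  Second, adding the variational inequalities of \<open>x\<close> and \<open>x'\<close> bounds \<open>(norm (A *v d))\<^sup>2\<close> by
  \<open>norm (b - b') * norm (A *v d)\<close> plus \<open>\<bar>l - l'\<bar>\<close> times the difference of the two l1-norms, and
  by the first estimate this difference is at most a multiple of \<open>norm (A *v d)\<close>. Dividing by
  \<open>norm (A *v d)\<close> gives a Lipschitz bound on \<open>A *v d\<close>, hence on \<open>d\<close>.
\<close>

section \<open>Kernel vectors and faces of orthants\<close>

text \<open>A coordinate outside both index sets is forced to be \<open>0\<close>, and one in both would be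
  unrestricted; for disjoint index sets this is a face of an orthant.\<close>

definition orthant_face :: "'n set \<Rightarrow> 'n set \<Rightarrow> (real ^ 'n) set"
  where "orthant_face P N = {k. \<forall>i. (i \<notin> P \<longrightarrow> k $ i \<le> 0) \<and> (i \<notin> N \<longrightarrow> 0 \<le> k $ i)}"

abbreviation sign_face :: "real ^ 'n \<Rightarrow> (real ^ 'n) set"
  where "sign_face d \<equiv> orthant_face {i. 0 < d $ i} {i. d $ i < 0}"

lemma closed_orthant_face: "closed (orthant_face P N :: (real ^ 'n) set)"
proof -
  have "orthant_face P N
      = (\<Inter>i\<in>-P. {k :: real ^ 'n. k $ i \<le> 0}) \<inter> (\<Inter>i\<in>-N. {k :: real ^ 'n. 0 \<le> k $ i})"
    unfolding orthant_face_def by auto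
  then show ?thesis
    by (auto intro!: closed_Int closed_INT closed_Collect_le continuous_intros)
qed

lemma scaleR_in_orthant_face:
  assumes "k \<in> orthant_face P N" "0 \<le> r"
  shows "r *\<^sub>R k \<in> orthant_face P N"
  using assms unfolding orthant_face_def
  by (auto simp: mult_nonneg_nonpos)

lemma norm_le_image_on_closed_cone:
  fixes A :: "real ^ 'n ^ 'm"
  assumes "closed K"
    and cone: "\<And>k r. k \<in> K \<Longrightarrow> 0 \<le> r \<Longrightarrow> r *\<^sub>R k \<in> K"
    and ker: "\<And>k. k \<in> K \<Longrightarrow> A *v k = 0 \<Longrightarrow> k = 0"
  shows "\<exists>c>0. \<forall>k\<in>K. norm k \<le> c * norm (A *v k)"
proof (cases "K \<inter> sphere 0 1 = {}")
  case True
  have "k = 0" if "k \<in> K" for k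
    using cone[OF that, of "inverse (norm k)"] True by (cases "k = 0") auto
  then have "\<forall>k\<in>K. norm k \<le> 1 * norm (A *v k)" by (metis mult_1 norm_ge_zero norm_zero)
  then show ?thesis using zero_less_one by blast
next
  case False
  have "compact (K \<inter> sphere 0 1)"
    using assms(1) by (simp add: closed_Int_compact)
  moreover have "continuous_on (K \<inter> sphere 0 1) (\<lambda>k. norm (A *v k))"
    by (intro continuous_intros matrix_vector_mult_linear_continuous_on)
  ultimately obtain e where e: "e \<in> K" "norm e = 1"
    and min: "\<And>k. k \<in> K \<Longrightarrow> norm k = 1 \<Longrightarrow> norm (A *v e) \<le> norm (A *v k)"
    using continuous_attains_inf[of "K \<inter> sphere 0 1" "\<lambda>k. norm (A *v k)"] False
    by (metis IntE IntI mem_sphere_0)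
  have pos: "0 < norm (A *v e)" using ker[OF e(1)] e(2) by auto
  have "norm k \<le> inverse (norm (A *v e)) * norm (A *v k)" if k: "k \<in> K" for k
  proof (cases "k = 0")
    case False
    have "norm (A *v e) \<le> norm (A *v (inverse (norm k) *\<^sub>R k))"
      using False cone[OF k, of "inverse (norm k)"] by (intro min) auto
    also have "\<dots> = norm (A *v k) / norm k"
      by (simp add: matrix_vector_mult_scaleR divide_inverse mult.commute)
    finally show ?thesis using pos False by (simp add: field_simps)
  qed auto
  then show ?thesis using pos by (intro exI[of _ "inverse (norm (A *v e))"]) auto
qed

text \<open>The face of \<open>d\<close> is determined by the two index sets where \<open>d\<close> is positive and negative, so
  only finitely many cones occur and the sum of their constants is a uniform one.\<close>

lemma norm_le_image_if_no_conformal_kernel: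
  fixes A :: "real ^ 'n ^ 'm"
  shows "\<exists>c>0. \<forall>d. (\<forall>k\<in>sign_face d. A *v k = 0 \<longrightarrow> k = 0) \<longrightarrow> norm d \<le> c * norm (A *v d)"
proof -
  have "\<exists>c>0. (\<forall>k\<in>orthant_face P N. A *v k = 0 \<longrightarrow> k = 0) \<longrightarrow>
      (\<forall>k\<in>orthant_face P N. norm k \<le> c * norm (A *v k))" for P N
  proof (cases "\<forall>k\<in>orthant_face P N. A *v k = 0 \<longrightarrow> k = 0")
    case True
    then show ?thesis
      using norm_le_image_on_closed_cone[of "orthant_face P N" A]
        closed_orthant_face scaleR_in_orthant_face by metis
  next
    case False
    then show ?thesis by (meson zero_less_one)
  qed
  then obtain C where pos: "\<And>P N. 0 < C P N"
    and C: "\<And>P N k. \<forall>k\<in>orthant_face P N. A *v k = 0 \<longrightarrow> k = 0 \<Longrightarrow> k \<in> orthant_face P N \<Longrightarrow>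
      norm k \<le> C P N * norm (A *v k)"
    by metis
  define c where "c = (\<Sum>(P, N)\<in>UNIV. C P N)"
  have le: "C P N \<le> c" for P N
  proof -
    have "(case (P, N) of (P, N) \<Rightarrow> C P N) \<le> c"
      unfolding c_def by (rule member_le_sum) (auto intro: less_imp_le pos)
    then show ?thesis by simp
  qed
  have "0 < c" using pos le by (meson less_le_trans)
  moreover have "norm d \<le> c * norm (A *v d)"
    if "\<forall>k\<in>sign_face d. A *v k = 0 \<longrightarrow> k = 0" for d
  proof -
    have "d \<in> sign_face d" by (auto simp: orthant_face_def)
    from C[OF that this] show ?thesis
      by (meson le mult_right_mono norm_ge_zero order_trans)
  qed
  ultimately show ?thesis by blast
qed

lemma sign_face_scaled_between:
  fixes d k :: "real ^ 'n"
  assumes "k \<in> sign_face d"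
  shows "\<exists>\<epsilon>>0. \<forall>i. (0 \<le> \<epsilon> * k $ i \<and> \<epsilon> * k $ i \<le> d $ i) \<or> (d $ i \<le> \<epsilon> * k $ i \<and> \<epsilon> * k $ i \<le> 0)"
proof -
  \<comment> \<open>Coordinates with \<open>d $ i = 0\<close> contribute \<open>0\<close> to the sum, since division by zero gives \<open>0\<close>.\<close>
  define s where "s = (\<Sum>i\<in>UNIV. \<bar>k $ i\<bar> / \<bar>d $ i\<bar>)"
  have s: "\<bar>k $ i\<bar> / \<bar>d $ i\<bar> \<le> s" for i
    unfolding s_def by (rule member_le_sum) auto
  have "0 \<le> s" unfolding s_def by (intro sum_nonneg) auto
  have "(0 \<le> 1 / (1 + s) * k $ i \<and> 1 / (1 + s) * k $ i \<le> d $ i)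
      \<or> (d $ i \<le> 1 / (1 + s) * k $ i \<and> 1 / (1 + s) * k $ i \<le> 0)" for i
  proof -
    have face: "\<not> 0 < d $ i \<Longrightarrow> k $ i \<le> 0" "\<not> d $ i < 0 \<Longrightarrow> 0 \<le> k $ i"
      using assms by (auto simp: orthant_face_def)
    have bound: "\<bar>k $ i\<bar> \<le> (1 + s) * \<bar>d $ i\<bar>" if "d $ i \<noteq> 0"
    proof -
      have "\<bar>k $ i\<bar> \<le> s * \<bar>d $ i\<bar>" using s[of i] that by (simp add: field_simps)
      then show ?thesis by (simp add: algebra_simps)
    qed
    consider "d $ i = 0" | "0 < d $ i" | "d $ i < 0" by linarith
    then show ?thesis
    proof cases
      case 1
      then show ?thesis using face by simp
    next
      case 2
      then show ?thesis using face bound \<open>0 \<le> s\<close> by (simp add: field_simps)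
    next
      case 3
      then show ?thesis using face bound \<open>0 \<le> s\<close> by (simp add: field_simps)
    qed
  qed
  then show ?thesis using \<open>0 \<le> s\<close> by (intro exI[of _ "1 / (1 + s)"]) auto
qed

section \<open>The l1-norm\<close>

lemma l1_norm_add_le: "l1_norm (x + y) \<le> l1_norm x + l1_norm y"
  unfolding l1_norm_def by (simp add: sum.distrib[symmetric] sum_mono abs_triangle_ineq)

lemma l1_norm_scaleR: "l1_norm (r *\<^sub>R x) = \<bar>r\<bar> * l1_norm x"
  unfolding l1_norm_def by (simp add: abs_mult sum_distrib_left)

lemma norm_le_l1_norm: "norm x \<le> l1_norm x"
  unfolding l1_norm_def by (rule norm_le_l1_cart)

lemma l1_norm_le_norm:
  fixes x :: "real ^ 'n"
  shows "l1_norm x \<le> real CARD('n) * norm x"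
  unfolding l1_norm_def using sum_bounded_above[of UNIV "\<lambda>i. \<bar>x $ i\<bar>" "norm x"]
  by (simp add: component_le_norm_cart)

lemma l1_norm_diff_le: "\<bar>l1_norm x - l1_norm y\<bar> \<le> l1_norm (x - y)"
proof -
  have "l1_norm x \<le> l1_norm (x - y) + l1_norm y" "l1_norm y \<le> l1_norm (y - x) + l1_norm x"
    using l1_norm_add_le[of "x - y" y] l1_norm_add_le[of "y - x" x] by auto
  moreover have "l1_norm (y - x) = l1_norm (x - y)"
    unfolding l1_norm_def by (simp add: abs_minus_commute)
  ultimately show ?thesis by linarith
qed

text \<open>In each coordinate \<open>x\<close>, \<open>x + k\<close> and \<open>x' - k\<close>, \<open>x'\<close> are the ends of two intervals of equal
  length, and the pair next to \<open>x'\<close> lies further in the direction of \<open>k\<close>; slopes of a convex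
  function increase in that direction.\<close>

lemma l1_norm_transfer:
  fixes x x' k :: "real ^ 'n"
  assumes "\<And>i. (0 \<le> k $ i \<and> k $ i \<le> (x' - x) $ i) \<or> ((x' - x) $ i \<le> k $ i \<and> k $ i \<le> 0)"
  shows "l1_norm (x + k) - l1_norm x \<le> l1_norm x' - l1_norm (x' - k)"
proof -
  have "\<bar>(x + k) $ i\<bar> - \<bar>x $ i\<bar> \<le> \<bar>x' $ i\<bar> - \<bar>(x' - k) $ i\<bar>" for i
    using assms[of i] by auto
  then show ?thesis
    unfolding l1_norm_def sum_subtractf[symmetric] by (intro sum_mono)
qed

lemma norm_diff_less_if_between:
  fixes d k :: "real ^ 'n"
  assumes between: "\<And>i. (0 \<le> k $ i \<and> k $ i \<le> d $ i) \<or> (d $ i \<le> k $ i \<and> k $ i \<le> 0)"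
    and "k \<noteq> 0"
  shows "norm (d - k) < norm d"
proof -
  have le: "((d - k) $ i)\<^sup>2 \<le> (d $ i)\<^sup>2" for i
    using between[of i] by (auto simp: abs_le_square_iff[symmetric])
  obtain j where "k $ j \<noteq> 0" using \<open>k \<noteq> 0\<close> by (auto simp: vec_eq_iff)
  then have "\<bar>(d - k) $ j\<bar> < \<bar>d $ j\<bar>"
    using between[of j] by auto
  then have "((d - k) $ j)\<^sup>2 < (d $ j)\<^sup>2"
    by (metis abs_ge_zero power2_abs power_strict_mono zero_less_numeral)
  then have "(\<Sum>i\<in>UNIV. ((d - k) $ i)\<^sup>2) < (\<Sum>i\<in>UNIV. (d $ i)\<^sup>2)"
    using le by (intro sum_strict_mono_ex1) auto
  then show ?thesis
    by (simp add: norm_vec_def L2_set_def)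
qed

section \<open>Solutions of the LASSO problem\<close>

lemma mem_lasso_solutions_iff:
  "x \<in> lasso_solutions A (b, l) \<longleftrightarrow> (\<forall>z. lasso_objective A b l x \<le> lasso_objective A b l z)"
  unfolding lasso_solutions_def is_arg_min_def by (auto simp: not_less)

lemma continuous_on_lasso_objective: "continuous_on S (lasso_objective A b l)"
  unfolding lasso_objective_def l1_norm_def
  by (intro continuous_intros matrix_vector_mult_linear_continuous_on)

lemma closed_lasso_solutions: "closed (lasso_solutions A (b, l))"
proof -
  have "lasso_solutions A (b, l)
      = (\<Inter>z. {x. lasso_objective A b l x \<le> lasso_objective A b l z})"
    by (auto simp: mem_lasso_solutions_iff)
  then show ?thesis
    by (auto intro!: closed_INT closed_Collect_le continuous_on_lasso_objective continuous_intros)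
qed

lemma lasso_solutions_nonempty:
  fixes A :: "real ^ 'n ^ 'm"
  assumes "0 < l"
  shows "lasso_solutions A (b, l) \<noteq> {}"
proof -
  let ?f = "lasso_objective A b l"
  define L where "L = {x. ?f x \<le> ?f 0}"
  have "norm x \<le> ?f 0 / l" if "x \<in> L" for x
  proof -
    have "l * norm x \<le> l * l1_norm x" using norm_le_l1_norm[of x] assms by simp
    also have "\<dots> \<le> ?f x" by (simp add: lasso_objective_def)
    also have "\<dots> \<le> ?f 0" using that by (simp add: L_def)
    finally show ?thesis using assms by (simp add: field_simps)
  qed
  then have "bounded L" by (auto simp: bounded_iff)
  moreover have "closed L"
    unfolding L_def by (intro closed_Collect_le continuous_on_lasso_objective continuous_intros)
  ultimately have "compact L" by (simp add: compact_eq_bounded_closed)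
  moreover have "0 \<in> L" by (simp add: L_def)
  ultimately obtain x where "x \<in> L" "\<And>z. z \<in> L \<Longrightarrow> ?f x \<le> ?f z"
    using continuous_attains_inf[of L ?f] continuous_on_lasso_objective by blast
  then have "x \<in> lasso_solutions A (b, l)"
    unfolding mem_lasso_solutions_iff L_def by (metis (mono_tags, lifting) linear mem_Collect_eq order_trans)
  then show ?thesis by blast
qed

text \<open>On the segment from \<open>x\<close> to \<open>z\<close> the l1-norm is bounded by linear interpolation, so only the
  quadratic term has to be expanded; the subdifferential of the l1-norm never enters.\<close>

lemma lasso_variational_inequality:
  fixes A :: "real ^ 'n ^ 'm"
  assumes "x \<in> lasso_solutions A (b, l)" "0 \<le> l"
  shows "0 \<le> (A *v x - b) \<bullet> (A *v (z - x)) + l * (l1_norm z - l1_norm x)"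
proof (rule ccontr)
  define w where "w = A *v (z - x)"
  define p where "p = (A *v x - b) \<bullet> w + l * (l1_norm z - l1_norm x)"
  define q where "q = (norm w)\<^sup>2 / 2"
  assume "\<not> 0 \<le> (A *v x - b) \<bullet> (A *v (z - x)) + l * (l1_norm z - l1_norm x)"
  then have "p < 0" by (simp add: p_def w_def)
  have "0 \<le> q" by (simp add: q_def)
  have step: "0 \<le> t * (p + t * q)" if "0 \<le> t" "t \<le> 1" for t
  proof -
    define y where "y = x + t *\<^sub>R (z - x)"
    have "y = (1 - t) *\<^sub>R x + t *\<^sub>R z" by (simp add: y_def algebra_simps)
    then have "l1_norm y \<le> (1 - t) * l1_norm x + t * l1_norm z"
      using l1_norm_add_le[of "(1 - t) *\<^sub>R x" "t *\<^sub>R z"] that by (simp add: l1_norm_scaleR)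
    then have "l * l1_norm y \<le> l * ((1 - t) * l1_norm x + t * l1_norm z)"
      using assms(2) by (rule mult_left_mono)
    moreover have "(norm (A *v y - b))\<^sup>2
        = (norm (A *v x - b))\<^sup>2 + 2 * t * ((A *v x - b) \<bullet> w) + t\<^sup>2 * (norm w)\<^sup>2"
    proof -
      have "A *v y - b = (A *v x - b) + t *\<^sub>R w"
        by (simp add: y_def w_def matrix_vector_right_distrib matrix_vector_mult_scaleR)
      then show ?thesis
        by (simp only: power2_norm_eq_inner)
          (simp add: inner_add_left inner_add_right inner_commute power2_eq_square algebra_simps)
    qed
    moreover have "lasso_objective A b l x \<le> lasso_objective A b l y"
      using assms(1) by (simp add: mem_lasso_solutions_iff)
    ultimately show ?thesis
      by (simp add: lasso_objective_def p_def q_def power2_eq_square algebra_simps)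
  qed
  \<comment> \<open>At this step length the first-order decrease outweighs the quadratic term.\<close>
  define t where "t = (- p) / (q - p)"
  have t: "0 < t" "t \<le> 1" using \<open>p < 0\<close> \<open>0 \<le> q\<close> by (auto simp: t_def field_simps)
  have "p + t * q = - (p * p) / (q - p)"
    using \<open>p < 0\<close> \<open>0 \<le> q\<close> by (simp add: t_def field_simps)
  also have "\<dots> < 0" using \<open>p < 0\<close> \<open>0 \<le> q\<close> by (simp add: divide_neg_pos mult_neg_neg)
  finally have "t * (p + t * q) < 0" using t by (simp add: mult_pos_neg)
  then show False using step[of t] t by simp
qed

text \<open>Both solutions are moved towards each other along the kernel; the fit to the data does not
  see such moves, so only the l1-norm decides.\<close>

lemma lasso_solution_minus_kernel:
  fixes A :: "real ^ 'n ^ 'm"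
  assumes x: "x \<in> lasso_solutions A (b, l)" and x': "x' \<in> lasso_solutions A (b', l')"
    and "0 < l" "0 \<le> l'" and ker: "A *v k = 0"
    and between: "\<And>i. (0 \<le> k $ i \<and> k $ i \<le> (x' - x) $ i) \<or> ((x' - x) $ i \<le> k $ i \<and> k $ i \<le> 0)"
  shows "x' - k \<in> lasso_solutions A (b', l')"
proof -
  have "lasso_objective A b l x \<le> lasso_objective A b l (x + k)"
    using x by (simp add: mem_lasso_solutions_iff)
  then have "l1_norm x \<le> l1_norm (x + k)"
    using \<open>0 < l\<close> ker by (simp add: lasso_objective_def matrix_vector_right_distrib)
  then have "l1_norm (x' - k) \<le> l1_norm x'"
    using l1_norm_transfer[of k x' x] between by simp
  then have "lasso_objective A b' l' (x' - k) \<le> lasso_objective A b' l' x'"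
    using \<open>0 \<le> l'\<close> ker
    by (simp add: lasso_objective_def matrix_vector_mult_diff_distrib mult_left_mono)
  then show ?thesis using x' by (meson mem_lasso_solutions_iff order_trans)
qed

lemma nearest_lasso_solution_no_conformal_kernel:
  fixes A :: "real ^ 'n ^ 'm"
  assumes x: "x \<in> lasso_solutions A (b, l)" and x': "x' \<in> lasso_solutions A (b', l')"
    and l: "0 < l" "0 \<le> l'"
    and nearest: "\<And>y. y \<in> lasso_solutions A (b', l') \<Longrightarrow> dist x x' \<le> dist x y"
    and k: "k \<in> sign_face (x' - x)" "A *v k = 0"
  shows "k = 0"
proof (rule ccontr)
  assume "k \<noteq> 0"
  obtain \<epsilon> where "0 < \<epsilon>" and
    between: "\<And>i. (0 \<le> (\<epsilon> *\<^sub>R k) $ i \<and> (\<epsilon> *\<^sub>R k) $ i \<le> (x' - x) $ i)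
      \<or> ((x' - x) $ i \<le> (\<epsilon> *\<^sub>R k) $ i \<and> (\<epsilon> *\<^sub>R k) $ i \<le> 0)"
    using sign_face_scaled_between[OF k(1)] by auto
  have "x' - \<epsilon> *\<^sub>R k \<in> lasso_solutions A (b', l')"
    using k(2) by (intro lasso_solution_minus_kernel[OF x x' l _ between])
      (simp add: matrix_vector_mult_scaleR)
  then have "norm (x' - x) \<le> norm (x' - \<epsilon> *\<^sub>R k - x)"
    using nearest by (simp only: dist_norm[symmetric] dist_commute[of _ x])
  also have "x' - \<epsilon> *\<^sub>R k - x = (x' - x) - \<epsilon> *\<^sub>R k"
    by simp
  finally have "norm (x' - x) \<le> norm ((x' - x) - \<epsilon> *\<^sub>R k)" .
  moreover have "norm ((x' - x) - \<epsilon> *\<^sub>R k) < norm (x' - x)"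
    using \<open>0 < \<epsilon>\<close> \<open>k \<noteq> 0\<close> by (intro norm_diff_less_if_between between) auto
  ultimately show False by simp
qed

section \<open>Lipschitz continuity\<close>

text \<open>The constant \<open>c\<close> enters twice: it turns a bound on \<open>A *v (x' - x)\<close> into one on
  \<open>x' - x\<close>, and it bounds the change of the l1-norm that multiplies \<open>l - l'\<close>.\<close>

lemma lasso_solution_near:
  fixes A :: "real ^ 'n ^ 'm"
  assumes "0 < c"
    and c: "\<And>d. \<forall>k\<in>sign_face d. A *v k = 0 \<longrightarrow> k = 0 \<Longrightarrow> norm d \<le> c * norm (A *v d)"
    and x: "x \<in> lasso_solutions A (b, l)" and l: "0 < l" "0 < l'"
  shows "\<exists>x'\<in>lasso_solutions A (b', l').
    dist x x' \<le> c * (1 + real CARD('n) * c) * norm ((b, l) - (b', l'))"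
proof -
  obtain x' where x': "x' \<in> lasso_solutions A (b', l')"
    and nearest: "\<And>y. y \<in> lasso_solutions A (b', l') \<Longrightarrow> dist x x' \<le> dist x y"
    using distance_attains_inf[OF closed_lasso_solutions lasso_solutions_nonempty[OF l(2)]] by blast
  define w where "w = A *v (x' - x)"
  define N where "N = norm ((b, l) - (b', l'))"
  define n where "n = real CARD('n)"
  have d: "norm (x' - x) \<le> c * norm w"
    unfolding w_def
    using nearest_lasso_solution_no_conformal_kernel[OF x x' l(1) less_imp_le[OF l(2)] nearest]
    by (intro c) blast
  have N: "norm (b' - b) \<le> N" "\<bar>l' - l\<bar> \<le> N"
    using norm_fst_le[of "b - b'" "l - l'"] norm_snd_le[of "l - l'" "b - b'"]
    by (auto simp: N_def norm_minus_commute)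
  have "\<bar>l1_norm x' - l1_norm x\<bar> \<le> n * norm (x' - x)"
    unfolding n_def by (rule order_trans[OF l1_norm_diff_le l1_norm_le_norm])
  also have "\<dots> \<le> n * (c * norm w)" using d by (simp add: n_def)
  finally have l1: "\<bar>l1_norm x' - l1_norm x\<bar> \<le> n * c * norm w" by simp
  have "0 \<le> (A *v x - b) \<bullet> w + l * (l1_norm x' - l1_norm x)"
    unfolding w_def using lasso_variational_inequality[OF x] l by simp
  moreover have "0 \<le> - ((A *v x' - b') \<bullet> w) + l' * (l1_norm x - l1_norm x')"
  proof -
    have "A *v (x - x') = - w" by (simp add: w_def matrix_vector_mult_diff_distrib)
    then show ?thesis using lasso_variational_inequality[OF x', of x] l by simp
  qed
  moreover have "(A *v x' - b') \<bullet> w - (A *v x - b) \<bullet> w = w \<bullet> w - (b' - b) \<bullet> w"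
    by (simp add: w_def matrix_vector_mult_diff_distrib inner_diff_left)
  ultimately have "w \<bullet> w \<le> (b' - b) \<bullet> w + (l - l') * (l1_norm x' - l1_norm x)"
    by (simp add: algebra_simps)
  also have "\<dots> \<le> norm (b' - b) * norm w + \<bar>l' - l\<bar> * \<bar>l1_norm x' - l1_norm x\<bar>"
    using norm_cauchy_schwarz[of "b' - b" w]
      abs_ge_self[of "(l - l') * (l1_norm x' - l1_norm x)"]
    by (simp add: abs_mult abs_minus_commute)
  also have "\<dots> \<le> N * norm w + N * (n * c * norm w)"
    using N l1 by (intro add_mono mult_mono) (auto simp: N_def)
  finally have "norm w * norm w \<le> (1 + n * c) * N * norm w"
    by (simp add: power2_norm_eq_inner[symmetric] power2_eq_square algebra_simps)
  moreover have "0 \<le> (1 + n * c) * N"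
    using \<open>0 < c\<close> by (simp add: n_def N_def)
  ultimately have "norm w \<le> (1 + n * c) * N"
    by (cases "w = 0") auto
  then have "c * norm w \<le> c * ((1 + n * c) * N)" using \<open>0 < c\<close> by simp
  then have "dist x x' \<le> c * (1 + n * c) * N"
    using d by (simp add: dist_norm norm_minus_commute mult.assoc)
  then show ?thesis using x' by (auto simp: N_def n_def)
qed

lemma excess_le:
  assumes "\<And>x. x \<in> C \<Longrightarrow> \<exists>y\<in>D. dist x y \<le> r"
  shows "excess C D \<le> ennreal r"
  unfolding excess_def point_set_dist_def
proof (rule SUP_least)
  fix x assume "x \<in> C"
  then obtain y where y: "y \<in> D" "dist x y \<le> r" using assms by blast
  then show "(INF y\<in>D. ennreal (dist x y)) \<le> ennreal r"
    by (intro INF_lower2[OF y(1)] ennreal_leI)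
qed

theorem theorem4p1:
  fixes A :: "real ^ 'n ^ 'm"
  shows "\<exists>\<kappa>::real. \<kappa> > 0 \<and>
    (\<forall>(b :: real ^ 'm) (b' :: real ^ 'm) (l :: real) (l' :: real). l > 0 \<longrightarrow> l' > 0 \<longrightarrow>
      hausdorff_dist (lasso_solutions A (b, l)) (lasso_solutions A (b', l'))
        \<le> ennreal (\<kappa> * norm ((b, l) - (b', l'))))"
proof -
  obtain c where "0 < c"
    and c: "\<And>d. \<forall>k\<in>sign_face d. A *v k = 0 \<longrightarrow> k = 0 \<Longrightarrow> norm d \<le> c * norm (A *v d)"
    using norm_le_image_if_no_conformal_kernel[of A] by blast
  define \<kappa> where "\<kappa> = c * (1 + real CARD('n) * c)"
  have excess: "excess (lasso_solutions A (b, l)) (lasso_solutions A (b', l'))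
      \<le> ennreal (\<kappa> * norm ((b, l) - (b', l')))" if "0 < l" "0 < l'" for b b' l l'
    unfolding \<kappa>_def using lasso_solution_near[OF \<open>0 < c\<close> c _ that] by (intro excess_le) blast
  have "hausdorff_dist (lasso_solutions A (b, l)) (lasso_solutions A (b', l'))
      \<le> ennreal (\<kappa> * norm ((b, l) - (b', l')))" if "0 < l" "0 < l'" for b b' l l'
    unfolding hausdorff_dist_def
    using excess[OF that, of b b'] excess[OF that(2) that(1), of b' b]
    by (metis max.bounded_iff norm_minus_commute)
  moreover have "0 < \<kappa>" using \<open>0 < c\<close> by (simp add: \<kappa>_def add_pos_nonneg)
  ultimately show ?thesis by blast
qed

end
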